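(* Let $k$ be a reproducing kernel on a non-empty set $\mathcal X$ with Hilbert function space $\mathcal H_k$, and let $b\in \mathrm{Mult}(\mathcal H_k\otimes\ell^2,\mathcal H_k)$ with $\|M_b\|\le 1$. Suppose that $\Delta=(I-M_b^*M_b)^{1/2}$ is injective and that: (i) for every $y\in\mathcal X$ there exists $d_y>0$ such that for all $e\in\ell^2$ $$|\langle g(y),e\rangle_{\ell^2}|\le d_y\|g\|_\Delta\|e\|_{\ell^2},\qquad g\in\mathcal H_k\otimes\ell^2$$ (equivalently, point evaluations are continuous on $\mathcal L_\Delta$); (ii) if $f\in\mathcal L_\Delta$ and $bf\in\mathcal H_k$, then $f\in\mathcal H_k\otimes\ell^2$. Then the linear span of $\{k_y:y\in\mathcal X\}$ is contained in $\mathcal H_k(b)$ and dense in $\mathcal H_k(b)$.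
   Context: A reproducing kernel on $\mathcal X$ is a positive semi-definite function $k:\mathcal X\times\mathcal X\to\mathbb C$; $\mathcal H_k$ is the Hilbert space of complex-valued functions on $\mathcal X$ with $f(y)=\langle f,k_y\rangle$, $k_y=k(\cdot,y)$. $\mathcal H_k\otimes\ell^2$ is the Hilbert space of functions $f=(f_0,f_1,\dots)^T:\mathcal X\to\ell^2$ with $f_j\in\mathcal H_k$ and $\|f\|^2=\sum_j\|f_j\|_{\mathcal H_k}^2<\infty$. A multiplier $b=(b_0,b_1,\dots)\in\mathrm{Mult}(\mathcal H_k\otimes\ell^2,\mathcal H_k)$ is a row-vector valued function on $\mathcal X$ such that $M_bf:=bf=\sum_j b_jf_j\in\mathcal H_k$ for every $f\in\mathcal H_k\otimes\ell^2$; $M_b$ is the resulting bounded operator. When $\|M_b\|\le1$, $\mathcal H_k(b)$ denotes the Hilbert function space on $\mathcal X$ with reproducing kernel $k^b(x,y)=k(x,y)(1-b(x)b(y)^* )$, where $b(x)b(y)^*=\sum_j b_j(x)\overline{b_j(y)}$. When $\Delta:\mathcal H_k\otimes\ell^2\to\mathcal H_k\otimes\ell^2$ is injective, $\|f\|_\Delta=\|\Delta f\|_{\mathcal H_k\otimes\ell^2}$ is a norm, and $\mathcal L_\Delta$ is the Hilbert space completion of $\mathcal H_k\otimes\ell^2$ in this norm; $\mathcal H_k\otimes\ell^2$ is regarded as a dense subspace of $\mathcal L_\Delta$. Under (i), each evaluation $g\mapsto g(y)$ extends continuously from $\mathcal H_k\otimes\ell^2$ to $\mathcal L_\Delta$,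 with values in $\ell^2$; for $f\in\mathcal L_\Delta$, $f(y)$ denotes the value of this extension, and $bf$ denotes the function $y\mapsto b(y)f(y)$ on $\mathcal X$. *)

theory Defs
  imports "HOL-Analysis.Analysis" "HOL-Library.Function_Algebras"
begin

class complex_vector = ab_group_add +
  fixes scaleC :: "complex \<Rightarrow> 'a \<Rightarrow> 'a"
  assumes scaleC_add_right: "scaleC a (x + y) = scaleC a x + scaleC a y"
    and scaleC_add_left: "scaleC (a + b) x = scaleC a x + scaleC b x"
    and scaleC_scaleC: "scaleC a (scaleC b x) = scaleC (a * b) x"
    and scaleC_one: "scaleC 1 x = x"

instantiation complex :: complex_vector
begin

definition scaleC_complex :: "complex \<Rightarrow> complex \<Rightarrow> complex" where
  "scaleC_complex c z = c * z"

instance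
  by standard (simp_all add: scaleC_complex_def algebra_simps)

end

instantiation "fun" :: (type, complex_vector) complex_vector
begin

definition scaleC_fun :: "complex \<Rightarrow> ('a \<Rightarrow> 'b) \<Rightarrow> 'a \<Rightarrow> 'b" where
  "scaleC_fun c f = (\<lambda>x. scaleC c (f x))"

instance
  by standard
    (simp_all add: scaleC_fun_def fun_eq_iff scaleC_add_right scaleC_add_left
      scaleC_scaleC scaleC_one)

end

global_interpretation complex_vector:
  vector_space "scaleC :: complex \<Rightarrow> 'a \<Rightarrow> 'a::complex_vector"
  defines csubspace = "complex_vector.subspace"
    and cspan = "complex_vector.span"
  by unfold_locales
    (simp_all add: scaleC_add_right scaleC_add_left scaleC_scaleC scaleC_one)


text \<open>
  An inner product space is given by the set of its vectors, inside an ambient complex vector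
  space, and an inner product that is meaningful on this set only. Inner products are linear in
  the first argument.
\<close>

record 'v ip_space =
  vecs :: "'v set"
  ip :: "'v \<Rightarrow> 'v \<Rightarrow> complex"

definition ip_norm :: "('v, 'm) ip_space_scheme \<Rightarrow> 'v \<Rightarrow> real" where
  "ip_norm H v = sqrt (Re (ip H v v))"

definition ip_tendsto ::
    "('v::complex_vector, 'm) ip_space_scheme \<Rightarrow> (nat \<Rightarrow> 'v) \<Rightarrow> 'v \<Rightarrow> bool" where
  "ip_tendsto H s v \<longleftrightarrow> (\<lambda>n. ip_norm H (s n - v)) \<longlonglongrightarrow> 0"

definition ip_Cauchy ::
    "('v::complex_vector, 'm) ip_space_scheme \<Rightarrow> (nat \<Rightarrow> 'v) \<Rightarrow> bool" where
  "ip_Cauchy H s \<longleftrightarrow> (\<forall>\<epsilon>>0. \<exists>N. \<forall>m\<ge>N. \<forall>n\<ge>N. ip_norm H (s m - s n) < \<epsilon>)"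

definition ip_dense ::
    "('v::complex_vector, 'm) ip_space_scheme \<Rightarrow> 'v set \<Rightarrow> bool" where
  "ip_dense H S \<longleftrightarrow>
     S \<subseteq> vecs H \<and> (\<forall>v\<in>vecs H. \<forall>\<epsilon>>0. \<exists>s\<in>S. ip_norm H (v - s) < \<epsilon>)"

locale complex_hilbert_space =
  fixes H :: "('v::complex_vector) ip_space"
  assumes subspace: "csubspace (vecs H)"
    and ip_add_left: "\<lbrakk>f \<in> vecs H; g \<in> vecs H; h \<in> vecs H\<rbrakk> \<Longrightarrow> ip H (f + g) h = ip H f h + ip H g h"
    and ip_scaleC_left: "\<lbrakk>f \<in> vecs H; g \<in> vecs H\<rbrakk> \<Longrightarrow> ip H (scaleC c f) g = c * ip H f g"
    and ip_commute: "\<lbrakk>f \<in> vecs H; g \<in> vecs H\<rbrakk> \<Longrightarrow> ip H g f = cnj (ip H f g)"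
    and ip_pos: "\<lbrakk>f \<in> vecs H; f \<noteq> 0\<rbrakk> \<Longrightarrow> 0 < Re (ip H f f)"
    and complete: "\<lbrakk>\<And>n. s n \<in> vecs H; ip_Cauchy H s\<rbrakk> \<Longrightarrow> \<exists>v\<in>vecs H. ip_tendsto H s v"


definition linear_op ::
    "('v::complex_vector) ip_space \<Rightarrow> ('w::complex_vector) ip_space \<Rightarrow> ('v \<Rightarrow> 'w) \<Rightarrow> bool" where
  "linear_op H K T \<longleftrightarrow>
     (\<forall>f\<in>vecs H. T f \<in> vecs K) \<and>
     (\<forall>f\<in>vecs H. \<forall>g\<in>vecs H. T (f + g) = T f + T g) \<and>
     (\<forall>c. \<forall>f\<in>vecs H. T (scaleC c f) = scaleC c (T f))"

definition op_norm_le ::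
    "('v::complex_vector) ip_space \<Rightarrow> ('w::complex_vector) ip_space \<Rightarrow> ('v \<Rightarrow> 'w) \<Rightarrow> real \<Rightarrow> bool" where
  "op_norm_le H K T C \<longleftrightarrow> (\<forall>f\<in>vecs H. ip_norm K (T f) \<le> C * ip_norm H f)"

definition bounded_op ::
    "('v::complex_vector) ip_space \<Rightarrow> ('w::complex_vector) ip_space \<Rightarrow> ('v \<Rightarrow> 'w) \<Rightarrow> bool" where
  "bounded_op H K T \<longleftrightarrow> linear_op H K T \<and> (\<exists>C. op_norm_le H K T C)"

definition is_adjoint ::
    "('v::complex_vector) ip_space \<Rightarrow> ('w::complex_vector) ip_space \<Rightarrow> ('v \<Rightarrow> 'w) \<Rightarrow> ('w \<Rightarrow> 'v) \<Rightarrow> bool" where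
  "is_adjoint H K T S \<longleftrightarrow>
     bounded_op K H S \<and> (\<forall>f\<in>vecs H. \<forall>g\<in>vecs K. ip K (T f) g = ip H f (S g))"

definition positive_op :: "('v::complex_vector) ip_space \<Rightarrow> ('v \<Rightarrow> 'v) \<Rightarrow> bool" where
  "positive_op H T \<longleftrightarrow> bounded_op H H T \<and> (\<forall>f\<in>vecs H. ip H (T f) f \<in> \<real>\<^sub>\<ge>\<^sub>0)"

definition is_positive_sqrt ::
    "('v::complex_vector) ip_space \<Rightarrow> ('v \<Rightarrow> 'v) \<Rightarrow> ('v \<Rightarrow> 'v) \<Rightarrow> bool" where
  "is_positive_sqrt H A D \<longleftrightarrow> positive_op H D \<and> (\<forall>f\<in>vecs H. D (D f) = A f)"

text \<open>
  \<open>L\<close> is a Hilbert space completion of the inner product space \<open>V\<close>, with \<open>J\<close> the embedding of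
  \<open>V\<close> as a dense subspace. Completions are unique up to a unitary respecting the embeddings.
\<close>

definition is_completion ::
    "('v::complex_vector) ip_space \<Rightarrow> ('l::complex_vector) ip_space \<Rightarrow> ('v \<Rightarrow> 'l) \<Rightarrow> bool" where
  "is_completion V L J \<longleftrightarrow>
     complex_hilbert_space L \<and> linear_op V L J \<and>
     (\<forall>f\<in>vecs V. \<forall>g\<in>vecs V. ip L (J f) (J g) = ip V f g) \<and>
     ip_dense L (J ` vecs V)"


definition psd_kernel :: "('x \<Rightarrow> 'x \<Rightarrow> complex) \<Rightarrow> bool" where
  "psd_kernel k \<longleftrightarrow>
     (\<forall>F c. finite F \<longrightarrow> (\<Sum>x\<in>F. \<Sum>y\<in>F. cnj (c x) * c y * k x y) \<in> \<real>\<^sub>\<ge>\<^sub>0)"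

text \<open>
  \<open>H\<close> is the Hilbert function space on \<open>'x\<close> with reproducing kernel \<open>k\<close>; these properties
  determine the set of vectors and the inner product on it.
\<close>

locale rkhs = complex_hilbert_space H
  for k :: "'x \<Rightarrow> 'x \<Rightarrow> complex" and H :: "('x \<Rightarrow> complex) ip_space" +
  assumes kernel_in: "(\<lambda>x. k x y) \<in> vecs H"
    and reproducing: "f \<in> vecs H \<Longrightarrow> f y = ip H f (\<lambda>x. k x y)"

definition ell2 :: "(nat \<Rightarrow> complex) ip_space" where
  "ell2 = \<lparr>vecs = {a. summable (\<lambda>j. (cmod (a j))\<^sup>2)}, ip = (\<lambda>a c. \<Sum>j. a j * cnj (c j))\<rparr>"

text \<open>Elements are written as functions of the point first: \<open>f x\<close> is the sequence \<open>(f\<^sub>j(x))\<^sub>j\<close>.\<close>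

definition tensor_ell2 :: "('x \<Rightarrow> complex) ip_space \<Rightarrow> ('x \<Rightarrow> nat \<Rightarrow> complex) ip_space" where
  "tensor_ell2 H =
     \<lparr>vecs = {f. (\<forall>j. (\<lambda>x. f x j) \<in> vecs H) \<and> summable (\<lambda>j. (ip_norm H (\<lambda>x. f x j))\<^sup>2)},
      ip = (\<lambda>f g. \<Sum>j. ip H (\<lambda>x. f x j) (\<lambda>x. g x j))\<rparr>"

definition mult_op :: "('x \<Rightarrow> nat \<Rightarrow> complex) \<Rightarrow> ('x \<Rightarrow> nat \<Rightarrow> complex) \<Rightarrow> 'x \<Rightarrow> complex" where
  "mult_op b f = (\<lambda>x. \<Sum>j. b x j * f x j)"

definition multiplier :: "('x \<Rightarrow> complex) ip_space \<Rightarrow> ('x \<Rightarrow> nat \<Rightarrow> complex) \<Rightarrow> bool" where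
  "multiplier H b \<longleftrightarrow>
     (\<forall>f\<in>vecs (tensor_ell2 H). (\<forall>x. summable (\<lambda>j. b x j * f x j)) \<and> mult_op b f \<in> vecs H)"

definition dbr_kernel ::
    "('x \<Rightarrow> 'x \<Rightarrow> complex) \<Rightarrow> ('x \<Rightarrow> nat \<Rightarrow> complex) \<Rightarrow> 'x \<Rightarrow> 'x \<Rightarrow> complex" where
  "dbr_kernel k b x y = k x y * (1 - (\<Sum>j. b x j * cnj (b y j)))"

text \<open>\<open>V\<close> with the inner product whose norm is \<open>f \<mapsto> \<parallel>D f\<parallel>\<close>.\<close>

definition renormed :: "'v ip_space \<Rightarrow> ('v \<Rightarrow> 'v) \<Rightarrow> 'v ip_space" where
  "renormed V D = \<lparr>vecs = vecs V, ip = (\<lambda>f g. ip V (D f) (D g))\<rparr>"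

text \<open>
  For every point \<open>y\<close>, \<open>f \<mapsto> E f y\<close> is the continuous extension to \<open>L\<close> of the evaluation at \<open>y\<close>
  on \<open>V\<close>, where \<open>V\<close> sits in \<open>L\<close> through \<open>J\<close>.
\<close>

definition is_eval_extension ::
    "('x \<Rightarrow> nat \<Rightarrow> complex) ip_space \<Rightarrow> ('l::complex_vector) ip_space \<Rightarrow>
     (('x \<Rightarrow> nat \<Rightarrow> complex) \<Rightarrow> 'l) \<Rightarrow> ('l \<Rightarrow> 'x \<Rightarrow> nat \<Rightarrow> complex) \<Rightarrow> bool" where
  "is_eval_extension V L J E \<longleftrightarrow>
     (\<forall>y. bounded_op L ell2 (\<lambda>f. E f y) \<and> (\<forall>g\<in>vecs V. E (J g) y = g y))"

end

(*
  Write M for M_b, M* for its adjoint, A = I - M M* and U for the span of the k_y. Then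
  A k_y = k^b_y, and for u in U
    |A u|^2 in H_k(b)  =  <A u, u>  =  |A u|^2 in H_k  +  |M* u|_Delta^2.
  Since u = A u + M M* u and f |-> (b f)(y) is bounded on L_Delta, u |-> u(y) is bounded in terms
  of the H_k(b)-norm of A u. The Riesz representative of A u |-> u(y) is k_y, so k_y lies in H_k(b)
  and <A u, k_y> = u(y) there.

  For density let G in H_k(b) be orthogonal to all k_y and choose u_n in U with A u_n -> G. By the
  norm identity A u_n -> G in H_k and M* u_n -> h in L_Delta. Now u_n(y) = <A u_n, k_y> -> 0, so
  G + b h = 0 and (ii) gives h in H_k (x) l^2. Finally <M q, A u_n> = <q, M* u_n>_Delta; in the
  limit, with q = h, this reads -|M h|^2 = |h|^2 - |M h|^2, so h = 0 and G = 0.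
*)
theory Submission
  imports Defs
begin

section \<open>Complex inner product spaces\<close>

lemma scaleC_apply: "scaleC c f x = c * f x" for f :: "'x \<Rightarrow> complex"
  by (simp add: scaleC_fun_def scaleC_complex_def)

text \<open>The Hilbert space axioms without completeness, so that \<open>tensor_ell2 Hk\<close> and
  \<open>ell2\<close> can be handled without a completeness proof. Limits are taken only in
  \<open>Hk\<close>, \<open>Hkb\<close> and \<open>L\<close>.\<close>

locale complex_inner_space =
  fixes H :: "('v::complex_vector) ip_space"
  assumes subspace: "csubspace (vecs H)"
    and ip_add_left: "\<lbrakk>f \<in> vecs H; g \<in> vecs H; h \<in> vecs H\<rbrakk> \<Longrightarrow> ip H (f + g) h = ip H f h + ip H g h"
    and ip_scaleC_left: "\<lbrakk>f \<in> vecs H; g \<in> vecs H\<rbrakk> \<Longrightarrow> ip H (scaleC c f) g = c * ip H f g"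
    and ip_commute: "\<lbrakk>f \<in> vecs H; g \<in> vecs H\<rbrakk> \<Longrightarrow> ip H g f = cnj (ip H f g)"
    and ip_pos: "\<lbrakk>f \<in> vecs H; f \<noteq> 0\<rbrakk> \<Longrightarrow> 0 < Re (ip H f f)"

sublocale complex_hilbert_space \<subseteq> complex_inner_space
  by unfold_locales (fact subspace ip_add_left ip_scaleC_left ip_commute ip_pos)+

context complex_inner_space
begin

lemma zero_mem: "0 \<in> vecs H"
  and add_mem: "f \<in> vecs H \<Longrightarrow> g \<in> vecs H \<Longrightarrow> f + g \<in> vecs H"
  and diff_mem: "f \<in> vecs H \<Longrightarrow> g \<in> vecs H \<Longrightarrow> f - g \<in> vecs H"
  and scaleC_mem: "f \<in> vecs H \<Longrightarrow> scaleC c f \<in> vecs H"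
  using subspace
  by (auto intro: complex_vector.subspace_0 complex_vector.subspace_add
      complex_vector.subspace_diff complex_vector.subspace_scale)

lemmas mem_intros = zero_mem add_mem diff_mem scaleC_mem

lemma ip_add_right:
  "\<lbrakk>f \<in> vecs H; g \<in> vecs H; h \<in> vecs H\<rbrakk> \<Longrightarrow> ip H f (g + h) = ip H f g + ip H f h"
  using ip_commute[of f "g + h"] ip_commute[of f g] ip_commute[of f h] ip_commute[of "g + h" f]
  by (simp add: ip_add_left mem_intros)

lemma ip_scaleC_right:
  "\<lbrakk>f \<in> vecs H; g \<in> vecs H\<rbrakk> \<Longrightarrow> ip H f (scaleC c g) = cnj c * ip H f g"
  using ip_commute[of "scaleC c g" f] ip_commute[of g f]
  by (simp add: ip_scaleC_left mem_intros)

lemma ip_diff_left: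
  "\<lbrakk>f \<in> vecs H; g \<in> vecs H; h \<in> vecs H\<rbrakk> \<Longrightarrow> ip H (f - g) h = ip H f h - ip H g h"
  using ip_add_left[of "f - g" g h] by (simp add: mem_intros)

lemma ip_diff_right:
  "\<lbrakk>f \<in> vecs H; g \<in> vecs H; h \<in> vecs H\<rbrakk> \<Longrightarrow> ip H f (g - h) = ip H f g - ip H f h"
  using ip_add_right[of f "g - h" h] by (simp add: mem_intros)

lemma ip_zero_left: "f \<in> vecs H \<Longrightarrow> ip H 0 f = 0"
  using ip_diff_left[of f f f] by simp

lemma ip_zero_right: "f \<in> vecs H \<Longrightarrow> ip H f 0 = 0"
  using ip_diff_right[of f f f] by simp

lemmas ip_simps = ip_add_left ip_add_right ip_diff_left ip_diff_right
  ip_scaleC_left ip_scaleC_right ip_zero_left ip_zero_right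

lemma Re_ip_self_nonneg: "f \<in> vecs H \<Longrightarrow> 0 \<le> Re (ip H f f)"
  using ip_pos[of f] ip_zero_left[of 0] by (cases "f = 0") (auto simp: mem_intros)

lemma ip_norm_nonneg: "f \<in> vecs H \<Longrightarrow> 0 \<le> ip_norm H f"
  by (simp add: ip_norm_def Re_ip_self_nonneg)

lemma ip_norm_sq: "f \<in> vecs H \<Longrightarrow> (ip_norm H f)\<^sup>2 = Re (ip H f f)"
  by (simp add: ip_norm_def Re_ip_self_nonneg)

lemma ip_self: "f \<in> vecs H \<Longrightarrow> ip H f f = of_real ((ip_norm H f)\<^sup>2)"
  using ip_commute[of f f] by (simp add: ip_norm_sq complex_eq_iff)

lemma ip_norm_eq_0_iff: "f \<in> vecs H \<Longrightarrow> ip_norm H f = 0 \<longleftrightarrow> f = 0"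
  using ip_pos[of f] ip_zero_left[of 0] zero_mem by (cases "f = 0") (auto simp: ip_norm_def)

lemma ip_norm_zero: "ip_norm H 0 = 0"
  by (simp add: ip_norm_eq_0_iff zero_mem)

lemma ip_norm_commute: "\<lbrakk>f \<in> vecs H; g \<in> vecs H\<rbrakk> \<Longrightarrow> ip_norm H (f - g) = ip_norm H (g - f)"
  by (simp add: ip_norm_def ip_simps mem_intros)

lemma ip_norm_scaleC_sq:
  "f \<in> vecs H \<Longrightarrow> (ip_norm H (scaleC c f))\<^sup>2 = (cmod c)\<^sup>2 * (ip_norm H f)\<^sup>2"
  by (simp add: ip_norm_sq mem_intros ip_simps cmod_power2)
    (simp add: ip_self power2_eq_square algebra_simps)

lemma ip_norm_add_sq:
  assumes "f \<in> vecs H" "g \<in> vecs H"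
  shows "(ip_norm H (f + g))\<^sup>2 = (ip_norm H f)\<^sup>2 + (ip_norm H g)\<^sup>2 + 2 * Re (ip H g f)"
  using assms ip_commute[of f g] by (simp add: ip_norm_sq mem_intros ip_simps)

lemma ip_norm_diff_sq:
  assumes "f \<in> vecs H" "g \<in> vecs H"
  shows "(ip_norm H (f - g))\<^sup>2 = (ip_norm H f)\<^sup>2 + (ip_norm H g)\<^sup>2 - 2 * Re (ip H g f)"
  using assms ip_commute[of f g] by (simp add: ip_norm_sq mem_intros ip_simps)

text \<open>The parallelogram law with the square of the norm of \<open>f - g\<close> dropped. It
  makes square-summable families closed under addition.\<close>

lemma ip_norm_add_sq_le:
  assumes "f \<in> vecs H" "g \<in> vecs H"
  shows "(ip_norm H (f + g))\<^sup>2 \<le> 2 * (ip_norm H f)\<^sup>2 + 2 * (ip_norm H g)\<^sup>2"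
  using ip_norm_add_sq[OF assms] ip_norm_diff_sq[OF assms]
  by (smt (verit) zero_le_power2)

lemma Cauchy_Schwarz:
  assumes f: "f \<in> vecs H" and g: "g \<in> vecs H"
  shows "cmod (ip H f g) \<le> ip_norm H f * ip_norm H g"
proof (cases "g = 0")
  case True
  then show ?thesis using f g by (simp add: ip_simps ip_norm_nonneg)
next
  case False
  define N where "N = (ip_norm H g)\<^sup>2"
  have N: "N > 0" using False g ip_norm_eq_0_iff by (simp add: N_def)
  \<comment> \<open>\<open>scaleC c g\<close> is the orthogonal projection of \<open>f\<close> to
    the line through \<open>g\<close>.\<close>
  define c where "c = ip H f g / of_real N"
  have "0 \<le> (ip_norm H (f - scaleC c g))\<^sup>2" by simp
  also have "\<dots> = (ip_norm H f)\<^sup>2 + (cmod c)\<^sup>2 * N - 2 * Re (c * ip H g f)"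
    using f g by (simp add: ip_norm_diff_sq ip_norm_scaleC_sq mem_intros N_def ip_simps)
  also have "c * ip H g f = of_real ((cmod (ip H f g))\<^sup>2 / N)"
    unfolding ip_commute[OF f g] c_def by (simp add: complex_norm_square[symmetric])
  also have "(cmod c)\<^sup>2 * N = (cmod (ip H f g))\<^sup>2 / N"
    using N by (simp add: c_def norm_divide power2_eq_square)
  finally have "(cmod (ip H f g))\<^sup>2 / N \<le> (ip_norm H f)\<^sup>2" by simp
  then have "(cmod (ip H f g))\<^sup>2 \<le> (ip_norm H f * ip_norm H g)\<^sup>2"
    using N by (simp add: N_def field_simps power_mult_distrib)
  then show ?thesis
    by (rule power2_le_imp_le) (use f g in \<open>simp add: ip_norm_nonneg\<close>)
qed

lemma tendsto_ip_left:
  assumes "\<And>n. s n \<in> vecs H" "v \<in> vecs H" "w \<in> vecs H" "ip_tendsto H s v"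
  shows "(\<lambda>n. ip H (s n) w) \<longlonglongrightarrow> ip H v w"
proof (rule LIM_zero_cancel, rule tendsto_0_le)
  show "(\<lambda>n. ip_norm H (s n - v)) \<longlonglongrightarrow> 0" using assms(4) by (simp add: ip_tendsto_def)
  show "\<forall>\<^sub>F n in sequentially. norm (ip H (s n) w - ip H v w) \<le> norm (ip_norm H (s n - v)) * ip_norm H w"
    using assms Cauchy_Schwarz[of "s _ - v" w]
    by (intro always_eventually) (simp add: ip_diff_left[symmetric] mem_intros ip_norm_nonneg)
qed

lemma tendsto_ip_right:
  assumes "\<And>n. s n \<in> vecs H" "v \<in> vecs H" "w \<in> vecs H" "ip_tendsto H s v"
  shows "(\<lambda>n. ip H w (s n)) \<longlonglongrightarrow> ip H w v"
  using tendsto_cnj[OF tendsto_ip_left[OF assms]] assms by (simp add: ip_commute[symmetric])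

lemma ip_norm_triangle:
  assumes f: "f \<in> vecs H" and g: "g \<in> vecs H"
  shows "ip_norm H (f + g) \<le> ip_norm H f + ip_norm H g"
proof (rule power2_le_imp_le)
  have "Re (ip H g f) \<le> ip_norm H g * ip_norm H f"
    using Cauchy_Schwarz[OF g f] complex_Re_le_cmod order_trans by blast
  then show "(ip_norm H (f + g))\<^sup>2 \<le> (ip_norm H f + ip_norm H g)\<^sup>2"
    by (simp add: ip_norm_add_sq[OF f g] power2_sum algebra_simps)
qed (use f g in \<open>simp add: ip_norm_nonneg\<close>)

lemma ip_tendsto_imp_Cauchy:
  assumes s: "\<And>n. s n \<in> vecs H" and v: "v \<in> vecs H" and lim: "ip_tendsto H s v"
  shows "ip_Cauchy H s"
  unfolding ip_Cauchy_def
proof (intro allI impI)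
  fix \<epsilon> :: real assume "\<epsilon> > 0"
  then have "\<forall>\<^sub>F n in sequentially. ip_norm H (s n - v) < \<epsilon> / 2"
    using lim unfolding ip_tendsto_def by (intro order_tendstoD(2)) auto
  then obtain N where N: "\<And>n. n \<ge> N \<Longrightarrow> ip_norm H (s n - v) < \<epsilon> / 2"
    by (auto simp: eventually_sequentially)
  show "\<exists>N. \<forall>m\<ge>N. \<forall>n\<ge>N. ip_norm H (s m - s n) < \<epsilon>"
  proof (intro exI allI impI)
    fix m n assume mn: "N \<le> m" "N \<le> n"
    have "ip_norm H (s m - s n) \<le> ip_norm H (s m - v) + ip_norm H (v - s n)"
      using ip_norm_triangle[of "s m - v" "v - s n"] s v by (simp add: mem_intros)
    also have "ip_norm H (v - s n) = ip_norm H (s n - v)" using s v by (simp add: ip_norm_commute)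
    finally show "ip_norm H (s m - s n) < \<epsilon>" using N[OF mn(1)] N[OF mn(2)] by linarith
  qed
qed

text \<open>Polarization: the imaginary parts of the form at \<open>f + g\<close> and at
  \<open>f + scaleC \<i> g\<close> vanish, which gives the imaginary and the real part of the
  identity. It supplies the self-adjointness of a positive operator, since
  \<open>positive_op\<close> speaks only of the quadratic form.\<close>

lemma symmetric_of_real_quadratic_form:
  assumes lin: "linear_op H H T" and real: "\<And>f. f \<in> vecs H \<Longrightarrow> ip H (T f) f \<in> \<real>"
    and f: "f \<in> vecs H" and g: "g \<in> vecs H"
  shows "ip H (T f) g = ip H f (T g)"
proof -
  have T: "T h \<in> vecs H" "T (h + h') = T h + T h'" "T (scaleC c h) = scaleC c (T h)"
    if "h \<in> vecs H" "h' \<in> vecs H" for h h' c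
    using lin that by (auto simp: linear_op_def)
  have "ip H (T (f + g)) (f + g) \<in> \<real>" "ip H (T (f + scaleC \<i> g)) (f + scaleC \<i> g) \<in> \<real>"
    "ip H (T f) f \<in> \<real>" "ip H (T g) g \<in> \<real>"
    using f g by (auto intro!: real mem_intros)
  then have "ip H (T f) g = cnj (ip H (T g) f)"
    using f g by (simp add: T ip_simps mem_intros complex_is_Real_iff complex_eq_iff)
  also have "\<dots> = ip H f (T g)" using f g by (simp add: T ip_commute[symmetric])
  finally show ?thesis .
qed

end


section \<open>Riesz representation on the range of a linear map\<close>

text \<open>
  The functional is presented as \<open>T u \<mapsto> \<phi> u\<close> on the range of \<open>T\<close>, which need not be closed:
  \<open>s\<close> is a minimizing sequence of \<open>\<parallel>T u\<parallel>\<^sup>2 - 2 Re (\<phi> u)\<close>, Cauchy by the parallelogram law.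
  Taking \<open>\<phi> u = \<langle>T u, x\<rangle>\<close> gives the orthogonal projection of \<open>x\<close> to the closure of the range.
\<close>

lemma (in complex_hilbert_space) riesz_representation:
  assumes U: "csubspace U"
    and T: "\<And>u. u \<in> U \<Longrightarrow> T u \<in> vecs H"
    and T_add: "\<And>u v. u \<in> U \<Longrightarrow> v \<in> U \<Longrightarrow> T (u + v) = T u + T v"
    and T_scaleC: "\<And>c u. u \<in> U \<Longrightarrow> T (scaleC c u) = scaleC c (T u)"
    and \<phi>_add: "\<And>u v. u \<in> U \<Longrightarrow> v \<in> U \<Longrightarrow> \<phi> (u + v) = \<phi> u + \<phi> v"
    and \<phi>_scaleC: "\<And>c u. u \<in> U \<Longrightarrow> \<phi> (scaleC c u) = c * \<phi> u"
    and bound: "\<And>u. u \<in> U \<Longrightarrow> cmod (\<phi> u) \<le> C * ip_norm H (T u)"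
  obtains v s where "v \<in> vecs H" "\<And>n. s n \<in> U" "ip_tendsto H (\<lambda>n. T (s n)) v"
    "\<And>u. u \<in> U \<Longrightarrow> ip H (T u) v = \<phi> u"
proof -
  define q where "q u = (ip_norm H (T u))\<^sup>2 - 2 * Re (\<phi> u)" for u
  define m where "m = Inf (q ` U)"
  have U_scaleC: "scaleC c u \<in> U" if "u \<in> U" for c u
    using U that by (rule complex_vector.subspace_scale)
  have U_add: "u + v \<in> U" if "u \<in> U" "v \<in> U" for u v
    using U that by (rule complex_vector.subspace_add)
  \<comment> \<open>Completing the square: \<open>q u\<close> is at least the square of
    \<open>ip_norm H (T u) - C\<close>, minus the square of \<open>C\<close>.\<close>
  have q_bound: "- (C\<^sup>2) \<le> q u" if "u \<in> U" for u
  proof -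
    have "Re (\<phi> u) \<le> C * ip_norm H (T u)"
      using bound[OF that] complex_Re_le_cmod order_trans by blast
    moreover have "0 \<le> (ip_norm H (T u) - C)\<^sup>2" by simp
    ultimately show ?thesis by (simp add: q_def power2_diff algebra_simps)
  qed
  have bdd: "bdd_below (q ` U)" using q_bound by (rule bdd_belowI2)
  have ne: "q ` U \<noteq> {}" using U complex_vector.subspace_0 by blast
  have m_le: "m \<le> q u" if "u \<in> U" for u
    unfolding m_def using that bdd by (simp add: cINF_lower)
  have "\<exists>u\<in>U. q u < m + 1 / Suc n" for n
    using cInf_lessD[OF ne, of "m + 1 / Suc n"] by (auto simp: m_def)
  then obtain s where s: "\<And>n. s n \<in> U" and qs: "\<And>n. q (s n) < m + 1 / Suc n" by metis
  have parallelogram: "(ip_norm H (T u - T v))\<^sup>2 \<le> 2 * (q u - m) + 2 * (q v - m)"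
    if u: "u \<in> U" and v: "v \<in> U" for u v
  proof -
    \<comment> \<open>At the midpoint \<open>w\<close> the linear terms of
      \<open>2 * q u + 2 * q v - 4 * q w\<close> cancel and the squared distance of
      \<open>T u\<close> and \<open>T v\<close> remains; then \<open>m \<le> q w\<close> bounds
      it.\<close>
    define w where "w = scaleC (1 / 2) (u + v)"
    have w: "w \<in> U" using u v by (simp add: w_def U_scaleC U_add)
    have "(ip_norm H (T u - T v))\<^sup>2 + (ip_norm H (T u + T v))\<^sup>2
        = 2 * (ip_norm H (T u))\<^sup>2 + 2 * (ip_norm H (T v))\<^sup>2"
      using T[OF u] T[OF v] by (simp add: ip_norm_diff_sq ip_norm_add_sq)
    moreover have "(ip_norm H (T u + T v))\<^sup>2 = 4 * (ip_norm H (T w))\<^sup>2"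
      using u v by (simp add: w_def T_scaleC T_add U_add T mem_intros ip_norm_scaleC_sq
          norm_divide power_divide)
    moreover have "Re (\<phi> u) + Re (\<phi> v) = 2 * Re (\<phi> w)"
      using u v by (simp add: w_def \<phi>_scaleC \<phi>_add U_add)
    ultimately show ?thesis using m_le[OF w] by (simp add: q_def)
  qed
  have "ip_Cauchy H (\<lambda>n. T (s n))"
    unfolding ip_Cauchy_def
  proof (intro allI impI)
    fix \<epsilon> :: real assume "\<epsilon> > 0"
    then obtain N where N: "inverse (real (Suc N)) < \<epsilon>\<^sup>2 / 4"
      using reals_Archimedean[of "\<epsilon>\<^sup>2 / 4"] by auto
    have quarters: "2 * a + 2 * b < e" if "a < e / 4" "b < e / 4" for a b e :: real
      using that by simp
    have small: "q (s n) - m < \<epsilon>\<^sup>2 / 4" if "n \<ge> N" for n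
    proof -
      have "1 / real (Suc n) \<le> inverse (real (Suc N))" using that by (simp add: field_simps)
      then show ?thesis using qs[of n] N by linarith
    qed
    show "\<exists>N. \<forall>m\<ge>N. \<forall>n\<ge>N. ip_norm H (T (s m) - T (s n)) < \<epsilon>"
    proof (intro exI allI impI)
      fix i j assume "N \<le> i" "N \<le> j"
      then have "q (s i) - m < \<epsilon>\<^sup>2 / 4" "q (s j) - m < \<epsilon>\<^sup>2 / 4" using small by blast+
      then have "(ip_norm H (T (s i) - T (s j)))\<^sup>2 < \<epsilon>\<^sup>2"
        by (intro le_less_trans[OF parallelogram[OF s[of i] s[of j]] quarters])
      then show "ip_norm H (T (s i) - T (s j)) < \<epsilon>"
        by (rule power2_less_imp_less) (use \<open>\<epsilon> > 0\<close> in simp)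
    qed
  qed
  then obtain v where v: "v \<in> vecs H" and lim: "ip_tendsto H (\<lambda>n. T (s n)) v"
    using complete[of "\<lambda>n. T (s n)"] T s by blast
  have "ip H (T u) v = \<phi> u" if u: "u \<in> U" for u
  proof -
    define \<delta> where "\<delta> = ip H (T u) v - \<phi> u"
    \<comment> \<open>First-order condition at the limit. Moving \<open>s n\<close> by
      \<open>scaleC t u\<close> cannot bring \<open>q\<close> below \<open>m\<close>, and
      \<open>q (s n)\<close> exceeds \<open>m\<close> by less than \<open>1 / Suc n\<close>; let
      \<open>n\<close> tend to infinity.\<close>
    have variation: "0 \<le> 2 * Re (t * \<delta>) + (cmod t)\<^sup>2 * (ip_norm H (T u))\<^sup>2" for t
    proof -
      define d where "d n = ip H (T u) (T (s n)) - \<phi> u" for n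
      have "d \<longlonglongrightarrow> \<delta>" unfolding d_def \<delta>_def
        by (intro tendsto_intros tendsto_ip_right lim v T s u)
      then have "(\<lambda>n. 1 / real (Suc n) + (2 * Re (t * d n) + (cmod t)\<^sup>2 * (ip_norm H (T u))\<^sup>2))
          \<longlonglongrightarrow> 0 + (2 * Re (t * \<delta>) + (cmod t)\<^sup>2 * (ip_norm H (T u))\<^sup>2)"
        by (intro tendsto_intros LIMSEQ_Suc[OF lim_1_over_n])
      moreover have "0 \<le> 1 / real (Suc n) + (2 * Re (t * d n) + (cmod t)\<^sup>2 * (ip_norm H (T u))\<^sup>2)" for n
      proof -
        have "m \<le> q (s n + scaleC t u)" by (intro m_le U_add U_scaleC s u)
        also have "\<dots> = q (s n) + 2 * Re (t * d n) + (cmod t)\<^sup>2 * (ip_norm H (T u))\<^sup>2"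
          using s u by (simp add: q_def d_def T_add T_scaleC U_scaleC T mem_intros
              ip_norm_add_sq ip_norm_scaleC_sq \<phi>_add \<phi>_scaleC ip_scaleC_left algebra_simps)
        finally show ?thesis using qs[of n] by linarith
      qed
      ultimately show ?thesis using LIMSEQ_le_const by fastforce
    qed
    define N where "N = (ip_norm H (T u))\<^sup>2"
    \<comment> \<open>With \<open>t = - r * cnj \<delta>\<close> the linear term is
      \<open>-2 * r\<close> times the squared modulus of \<delta>. As \<open>r * N \<le> 1\<close>,
      the quadratic term offsets at most half of it, so \<delta> must vanish. The summand 1 covers
      \<open>T u = 0\<close>.\<close>
    define r where "r = 1 / (N + 1)"
    have "N \<ge> 0" by (simp add: N_def)
    then have r: "r > 0" "r * N \<le> 1" by (auto simp: r_def field_simps)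
    have "Re (cnj \<delta> * \<delta>) = (cmod \<delta>)\<^sup>2"
      using complex_norm_square[of \<delta>] by (metis Re_complex_of_real mult.commute of_real_power)
    then have "0 \<le> - (2 * (r * (cmod \<delta>)\<^sup>2)) + (r * cmod \<delta>)\<^sup>2 * N"
      using variation[of "- (of_real r * cnj \<delta>)"] r
      by (simp add: N_def norm_mult mult.assoc)
    also have "(r * cmod \<delta>)\<^sup>2 * N = (r * (cmod \<delta>)\<^sup>2) * (r * N)"
      by (simp add: power2_eq_square)
    also have "\<dots> \<le> (r * (cmod \<delta>)\<^sup>2) * 1" using r by (intro mult_left_mono) auto
    finally have "r * (cmod \<delta>)\<^sup>2 \<le> 0" by linarith
    then have "\<delta> = 0" using r by (simp add: mult_le_0_iff)
    then show ?thesis by (simp add: \<delta>_def)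
  qed
  then show thesis using that v s lim by blast
qed

section \<open>Square-summable sequences of vectors\<close>

text \<open>Moves the inner product axioms along an injective linear map. The map used is the
  exchange of the two arguments, because elements of \<open>tensor_ell2\<close> take the point first
  and those of \<open>ell2_sum\<close> take the index first.\<close>

lemma complex_inner_space_pullback:
  fixes \<Phi> :: "'v::complex_vector \<Rightarrow> 'w::complex_vector"
  assumes W: "complex_inner_space W"
    and add: "\<And>f g. \<Phi> (f + g) = \<Phi> f + \<Phi> g" and scaleC: "\<And>c f. \<Phi> (scaleC c f) = scaleC c (\<Phi> f)"
    and inj: "\<And>f. \<Phi> f = 0 \<Longrightarrow> f = 0"
    and vecs: "vecs V = \<Phi> -` vecs W" and ip: "ip V = (\<lambda>f g. ip W (\<Phi> f) (\<Phi> g))"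
  shows "complex_inner_space V"
proof -
  interpret W: complex_inner_space W by fact
  have zero: "\<Phi> 0 = 0" using add[of 0 0] by simp
  show ?thesis
  proof
    show "csubspace (vecs V)"
      by (auto intro!: complex_vector.subspaceI simp: vecs add scaleC zero W.mem_intros)
    show "ip V g f = cnj (ip V f g)" if "f \<in> vecs V" "g \<in> vecs V" for f g
      using W.ip_commute[of "\<Phi> f" "\<Phi> g"] that by (simp add: vecs ip)
    show "0 < Re (ip V f f)" if "f \<in> vecs V" "f \<noteq> 0" for f
      using that inj[of f] W.ip_pos[of "\<Phi> f"] by (auto simp: vecs ip)
  qed (auto simp: vecs ip add scaleC W.ip_simps)
qed

text \<open>A common source for two spaces: \<open>tensor_ell2 H\<close> is this sum up to the order
  of arguments, and \<open>ell2\<close> is the case where \<open>H\<close> is the field of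
  scalars.\<close>

definition ell2_sum :: "('v::complex_vector) ip_space \<Rightarrow> (nat \<Rightarrow> 'v) ip_space" where
  "ell2_sum H =
     \<lparr>vecs = {f. (\<forall>j. f j \<in> vecs H) \<and> summable (\<lambda>j. (ip_norm H (f j))\<^sup>2)},
      ip = (\<lambda>f g. \<Sum>j. ip H (f j) (g j))\<rparr>"

lemma complex_inner_space_ell2_sum:
  assumes "complex_inner_space H"
  shows "complex_inner_space (ell2_sum H)"
proof -
  interpret complex_inner_space H by fact
  have summable_ip: "summable (\<lambda>j. ip H (f j) (g j))"
    if "f \<in> vecs (ell2_sum H)" "g \<in> vecs (ell2_sum H)" for f g
  proof (rule summable_comparison_test')
    show "summable (\<lambda>j. (ip_norm H (f j))\<^sup>2 + (ip_norm H (g j))\<^sup>2)"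
      using that by (simp add: ell2_sum_def summable_add)
    show "norm (ip H (f j) (g j)) \<le> (ip_norm H (f j))\<^sup>2 + (ip_norm H (g j))\<^sup>2" for j
    proof -
      have "norm (ip H (f j) (g j)) \<le> ip_norm H (f j) * ip_norm H (g j)"
        using that by (simp add: ell2_sum_def Cauchy_Schwarz)
      then show ?thesis
        using sum_squares_bound[of "ip_norm H (f j)" "ip_norm H (g j)"]
          zero_le_power2[of "ip_norm H (f j)"] zero_le_power2[of "ip_norm H (g j)"] by linarith
    qed
  qed
  show ?thesis
  proof
    show "csubspace (vecs (ell2_sum H))"
    proof (rule complex_vector.subspaceI)
      show "f + g \<in> vecs (ell2_sum H)" if "f \<in> vecs (ell2_sum H)" "g \<in> vecs (ell2_sum H)" for f g
      proof -
        have "summable (\<lambda>j. (ip_norm H (f j + g j))\<^sup>2)"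
        proof (rule summable_comparison_test')
          show "summable (\<lambda>j. 2 * (ip_norm H (f j))\<^sup>2 + 2 * (ip_norm H (g j))\<^sup>2)"
            using that by (auto simp: ell2_sum_def intro!: summable_add summable_mult)
          show "norm ((ip_norm H (f j + g j))\<^sup>2) \<le> 2 * (ip_norm H (f j))\<^sup>2 + 2 * (ip_norm H (g j))\<^sup>2" for j
            using that by (simp add: ell2_sum_def ip_norm_add_sq_le)
        qed
        then show ?thesis using that by (simp add: ell2_sum_def mem_intros)
      qed
    qed (auto simp: ell2_sum_def mem_intros scaleC_fun_def ip_norm_scaleC_sq summable_mult
        ip_norm_zero)
    show "ip (ell2_sum H) (f + g) h = ip (ell2_sum H) f h + ip (ell2_sum H) g h"
      if "f \<in> vecs (ell2_sum H)" "g \<in> vecs (ell2_sum H)" "h \<in> vecs (ell2_sum H)" for f g h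
      using suminf_add[OF summable_ip summable_ip, of f h g h] that
      by (simp add: ell2_sum_def ip_add_left)
    show "ip (ell2_sum H) (scaleC c f) g = c * ip (ell2_sum H) f g"
      if "f \<in> vecs (ell2_sum H)" "g \<in> vecs (ell2_sum H)" for c f g
      using suminf_mult[OF summable_ip, of f g c] that
      by (simp add: ell2_sum_def ip_scaleC_left scaleC_fun_def)
    show "ip (ell2_sum H) g f = cnj (ip (ell2_sum H) f g)"
      if "f \<in> vecs (ell2_sum H)" "g \<in> vecs (ell2_sum H)" for f g
    proof -
      have "(\<lambda>j. cnj (ip H (f j) (g j))) sums cnj (\<Sum>j. ip H (f j) (g j))"
        using summable_sums[OF summable_ip[OF that]] by (simp add: sums_cnj)
      moreover have "cnj (ip H (f j) (g j)) = ip H (g j) (f j)" for j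
        using that by (simp add: ell2_sum_def ip_commute[symmetric])
      ultimately show ?thesis by (simp add: ell2_sum_def sums_unique[symmetric])
    qed
    show "0 < Re (ip (ell2_sum H) f f)" if f: "f \<in> vecs (ell2_sum H)" and "f \<noteq> 0" for f
    proof -
      obtain i where i: "f i \<noteq> 0" using \<open>f \<noteq> 0\<close> by (auto simp: fun_eq_iff)
      have fj: "f j \<in> vecs H" for j using f by (simp add: ell2_sum_def)
      have "Re (ip (ell2_sum H) f f) = (\<Sum>j. Re (ip H (f j) (f j)))"
        using Re_suminf[OF summable_ip[OF f f]] by (simp add: ell2_sum_def)
      also have "\<dots> > 0"
        using f i fj by (intro suminf_pos2[of _ i])
          (auto simp: Re_ip_self_nonneg ip_pos ip_norm_sq ell2_sum_def)
      finally show ?thesis .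
    qed
  qed
qed

lemma complex_inner_space_tensor_ell2:
  assumes "complex_inner_space H"
  shows "complex_inner_space (tensor_ell2 H)"
  using complex_inner_space_ell2_sum[OF assms]
  by (rule complex_inner_space_pullback[where \<Phi> = "\<lambda>f j x. f x j"])
    (auto simp: tensor_ell2_def ell2_sum_def scaleC_fun_def fun_eq_iff)

lemma complex_inner_space_ell2: "complex_inner_space ell2"
proof -
  define C :: "complex ip_space" where "C = \<lparr>vecs = UNIV, ip = (\<lambda>z w. z * cnj w)\<rparr>"
  have "complex_inner_space C"
    by unfold_locales (auto simp: C_def scaleC_complex_def algebra_simps complex_neq_0
        simp flip: power2_eq_square)
  moreover have "ip_norm C = cmod"
    by (simp add: C_def ip_norm_def cmod_def power2_eq_square fun_eq_iff)
  then have "ell2 = ell2_sum C" by (simp add: ell2_def ell2_sum_def C_def)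
  ultimately show ?thesis using complex_inner_space_ell2_sum by metis
qed

section \<open>The multiplier, its adjoint and the completion\<close>

locale row_multiplier =
  Hk: rkhs k Hk + Hkb: rkhs "dbr_kernel k b" Hkb + L: complex_hilbert_space L
  for k :: "'x \<Rightarrow> 'x \<Rightarrow> complex" and Hk :: "('x \<Rightarrow> complex) ip_space"
    and b :: "'x \<Rightarrow> nat \<Rightarrow> complex" and Hkb :: "('x \<Rightarrow> complex) ip_space"
    and L :: "('l::complex_vector) ip_space" +
  fixes Madj :: "('x \<Rightarrow> complex) \<Rightarrow> 'x \<Rightarrow> nat \<Rightarrow> complex"
    and \<Delta> :: "('x \<Rightarrow> nat \<Rightarrow> complex) \<Rightarrow> 'x \<Rightarrow> nat \<Rightarrow> complex"
    and J :: "('x \<Rightarrow> nat \<Rightarrow> complex) \<Rightarrow> 'l"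
    and E :: "'l \<Rightarrow> 'x \<Rightarrow> nat \<Rightarrow> complex"
  assumes mult: "multiplier Hk b"
    and adj: "is_adjoint (tensor_ell2 Hk) Hk (mult_op b) Madj"
    and Delta: "is_positive_sqrt (tensor_ell2 Hk) (\<lambda>f. f - Madj (mult_op b f)) \<Delta>"
    and compl: "is_completion (renormed (tensor_ell2 Hk) \<Delta>) L J"
    and eval: "is_eval_extension (tensor_ell2 Hk) L J E"
begin

abbreviation "K \<equiv> tensor_ell2 Hk"
abbreviation "M \<equiv> mult_op b"
abbreviation "kf y \<equiv> \<lambda>x. k x y"
abbreviation "kb y \<equiv> \<lambda>x. dbr_kernel k b x y"

sublocale K: complex_inner_space "tensor_ell2 Hk"
  by (rule complex_inner_space_tensor_ell2) unfold_locales

lemma M_mem: "f \<in> vecs K \<Longrightarrow> M f \<in> vecs Hk"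
  and M_summable: "f \<in> vecs K \<Longrightarrow> summable (\<lambda>j. b x j * f x j)"
  using mult by (auto simp: multiplier_def)

lemma M_add: "\<lbrakk>f \<in> vecs K; g \<in> vecs K\<rbrakk> \<Longrightarrow> M (f + g) = M f + M g"
  using suminf_add[OF M_summable M_summable, of f g]
  by (simp add: mult_op_def fun_eq_iff algebra_simps)

lemma M_scaleC: "f \<in> vecs K \<Longrightarrow> M (scaleC c f) = scaleC c (M f)"
  using suminf_mult[OF M_summable, of f c]
  by (simp add: mult_op_def fun_eq_iff scaleC_fun_def scaleC_complex_def algebra_simps)

lemma Madj_mem: "u \<in> vecs Hk \<Longrightarrow> Madj u \<in> vecs K"
  and Madj_add: "\<lbrakk>u \<in> vecs Hk; v \<in> vecs Hk\<rbrakk> \<Longrightarrow> Madj (u + v) = Madj u + Madj v"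
  and Madj_scaleC: "u \<in> vecs Hk \<Longrightarrow> Madj (scaleC c u) = scaleC c (Madj u)"
  and ip_M: "\<lbrakk>f \<in> vecs K; u \<in> vecs Hk\<rbrakk> \<Longrightarrow> ip Hk (M f) u = ip K f (Madj u)"
  using adj by (auto simp: is_adjoint_def bounded_op_def linear_op_def)

lemma J_mem: "f \<in> vecs K \<Longrightarrow> J f \<in> vecs L"
  and J_add: "\<lbrakk>f \<in> vecs K; g \<in> vecs K\<rbrakk> \<Longrightarrow> J (f + g) = J f + J g"
  and J_dense: "\<lbrakk>h \<in> vecs L; \<epsilon> > 0\<rbrakk> \<Longrightarrow> \<exists>f\<in>vecs K. ip_norm L (h - J f) < \<epsilon>"
  using compl by (auto simp: is_completion_def linear_op_def renormed_def ip_dense_def)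

lemma J_diff: "\<lbrakk>f \<in> vecs K; g \<in> vecs K\<rbrakk> \<Longrightarrow> J (f - g) = J f - J g"
  using J_add[of "f - g" g] by (simp add: K.mem_intros algebra_simps)

lemma Madj_diff: "\<lbrakk>f \<in> vecs Hk; g \<in> vecs Hk\<rbrakk> \<Longrightarrow> Madj (f - g) = Madj f - Madj g"
  using Madj_add[of "f - g" g] by (simp add: Hk.mem_intros algebra_simps)

text \<open>The inner product of \<open>L\<close> on the image of \<open>J\<close> is that of the
  images under \<Delta>, and self-adjointness of \<Delta> turns it into the form of I - M* M. From
  here on the space \<open>L\<close> is computed with through \<open>M\<close> alone.\<close>

lemma ip_J:
  assumes f: "f \<in> vecs K" and g: "g \<in> vecs K"
  shows "ip L (J f) (J g) = ip K f g - ip Hk (M f) (M g)"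
proof -
  have lin: "linear_op K K \<Delta>" and real: "ip K (\<Delta> h) h \<in> \<real>" and sq: "\<Delta> (\<Delta> h) = h - Madj (M h)"
    if "h \<in> vecs K" for h
    using Delta that nonneg_Reals_subset_Reals
    by (auto simp: is_positive_sqrt_def positive_op_def bounded_op_def)
  have \<Delta>f: "\<Delta> f \<in> vecs K" using lin[OF f] f by (simp add: linear_op_def)
  have "ip L (J f) (J g) = ip K (\<Delta> f) (\<Delta> g)"
    using compl f g by (simp add: is_completion_def renormed_def)
  also have "\<dots> = ip K (\<Delta> (\<Delta> f)) g"
    by (rule K.symmetric_of_real_quadratic_form[OF lin[OF f] real \<Delta>f g, symmetric])
  also have "\<dots> = ip K f g - ip K (Madj (M f)) g"
    using f g by (simp add: sq K.ip_diff_left Madj_mem M_mem)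
  also have "ip K (Madj (M f)) g = cnj (ip Hk (M g) (M f))"
    using f g by (simp add: ip_M M_mem Madj_mem K.ip_commute[symmetric])
  also have "\<dots> = ip Hk (M f) (M g)" using f g by (simp add: M_mem Hk.ip_commute[symmetric])
  finally show ?thesis .
qed

text \<open>The elementary tensor of \<open>f\<close> with the \<open>i\<close>-th unit vector.
  Pairing with it isolates the \<open>i\<close>-th component of an element of
  \<open>K\<close>.\<close>

definition single :: "('x \<Rightarrow> complex) \<Rightarrow> nat \<Rightarrow> 'x \<Rightarrow> nat \<Rightarrow> complex" where
  "single f i = (\<lambda>x j. if j = i then f x else 0)"

lemma single_component: "(\<lambda>x. single f i x j) = (if j = i then f else 0)"
  by (auto simp: single_def)

lemma single_mem: "f \<in> vecs Hk \<Longrightarrow> single f i \<in> vecs K"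
proof -
  assume f: "f \<in> vecs Hk"
  have "summable (\<lambda>j. (ip_norm Hk (if j = i then f else 0))\<^sup>2)"
    by (rule summable_finite[of "{i}"]) (auto simp: Hk.ip_norm_zero)
  then show ?thesis using f by (auto simp: tensor_ell2_def single_component Hk.mem_intros)
qed

lemma component_mem: "g \<in> vecs K \<Longrightarrow> (\<lambda>x. g x j) \<in> vecs Hk"
  by (simp add: tensor_ell2_def)

lemma ip_single:
  assumes "f \<in> vecs Hk" "g \<in> vecs K"
  shows "ip K g (single f i) = ip Hk (\<lambda>x. g x i) f"
proof -
  have "(\<Sum>j. ip Hk (\<lambda>x. g x j) (if j = i then f else 0))
      = (\<Sum>j\<in>{i}. ip Hk (\<lambda>x. g x j) (if j = i then f else 0))"
    using assms component_mem by (intro suminf_finite) (auto simp: Hk.ip_zero_right)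
  then show ?thesis by (simp add: tensor_ell2_def single_component)
qed

lemma M_single: "M (single f i) x = b x i * f x"
proof -
  have "(\<Sum>j. b x j * (if j = i then f x else 0)) = (\<Sum>j\<in>{i}. b x j * (if j = i then f x else 0))"
    by (rule suminf_finite) auto
  then show ?thesis by (simp add: mult_op_def single_def)
qed

lemma kernel_commute: "k y x = cnj (k x y)"
  using Hk.ip_commute[OF Hk.kernel_in Hk.kernel_in, of x y]
    Hk.reproducing[OF Hk.kernel_in[of x], of y] Hk.reproducing[OF Hk.kernel_in[of y], of x] by simp

text \<open>Pair M* k_y with the elementary tensor of k_x and the \<open>j\<close>-th unit vector:
  reproduction at \<open>x\<close> reads off the entry, while moving \<open>M\<close> across and
  reproducing at \<open>y\<close> evaluates the pairing.\<close>

lemma Madj_kernel: "Madj (kf y) x j = k x y * cnj (b y j)"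
proof -
  have "Madj (kf y) x j = ip Hk (\<lambda>x. Madj (kf y) x j) (kf x)"
    by (rule Hk.reproducing) (simp add: component_mem Madj_mem Hk.kernel_in)
  also have "\<dots> = ip K (Madj (kf y)) (single (kf x) j)"
    by (simp add: ip_single Madj_mem Hk.kernel_in)
  also have "\<dots> = cnj (ip K (single (kf x) j) (Madj (kf y)))"
    by (simp add: single_mem Madj_mem Hk.kernel_in K.ip_commute[symmetric])
  also have "\<dots> = cnj (ip Hk (M (single (kf x) j)) (kf y))"
    by (simp add: ip_M single_mem Hk.kernel_in)
  also have "\<dots> = cnj (M (single (kf x) j) y)"
    by (simp add: Hk.reproducing[symmetric] M_mem single_mem Hk.kernel_in)
  finally show ?thesis using kernel_commute[of y x] by (simp add: M_single)
qed

section \<open>The operator I - M M* on the span of the kernel functions\<close>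

definition A :: "('x \<Rightarrow> complex) \<Rightarrow> 'x \<Rightarrow> complex" where
  "A u = u - M (Madj u)"

lemma A_mem: "u \<in> vecs Hk \<Longrightarrow> A u \<in> vecs Hk"
  by (simp add: A_def Hk.mem_intros M_mem Madj_mem)

lemma A_add: "\<lbrakk>u \<in> vecs Hk; v \<in> vecs Hk\<rbrakk> \<Longrightarrow> A (u + v) = A u + A v"
  by (simp add: A_def Madj_add M_add Madj_mem)

lemma A_scaleC: "u \<in> vecs Hk \<Longrightarrow> A (scaleC c u) = scaleC c (A u)"
  by (simp add: A_def Madj_scaleC M_scaleC Madj_mem complex_vector.scale_right_diff_distrib)

lemma A_diff: "\<lbrakk>u \<in> vecs Hk; v \<in> vecs Hk\<rbrakk> \<Longrightarrow> A (u - v) = A u - A v"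
  using A_add[of "u - v" v] by (simp add: Hk.mem_intros algebra_simps)

lemma A_kernel: "A (kf y) = kb y"
proof
  fix x
  have "M (Madj (kf y)) x = k x y * (\<Sum>j. b x j * cnj (b y j))"
  \<comment> \<open>Where \<open>k x y\<close> is nonzero, the series of
    \<open>b x j * cnj (b y j)\<close> converges because \<open>k x y\<close> times it is the series
    for M M* k_y at \<open>x\<close>. Where \<open>k x y\<close> is zero, both sides are zero
    without any claim of convergence.\<close>
  proof (cases "k x y = 0")
    case False
    have "summable (\<lambda>j. b x j * (k x y * cnj (b y j)))"
      using M_summable[OF Madj_mem[OF Hk.kernel_in[of y]], of x] by (simp add: Madj_kernel)
    from summable_mult[OF this, of "1 / k x y"] False
    have "summable (\<lambda>j. b x j * cnj (b y j))" by simp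
    from suminf_mult[OF this, of "k x y"] show ?thesis
      by (simp add: mult_op_def Madj_kernel algebra_simps)
  qed (simp add: mult_op_def Madj_kernel)
  then show "A (kf y) x = kb y x" by (simp add: A_def dbr_kernel_def algebra_simps)
qed

text \<open>Moving \<open>M\<close> across turns the left side into the form of I - M* M at
  \<open>g\<close> and \<open>Madj u\<close>, which is the inner product of \<open>L\<close>. It
  serves both the norm identity and the final passage to the limit.\<close>

lemma ip_M_A:
  assumes g: "g \<in> vecs K" and u: "u \<in> vecs Hk"
  shows "ip Hk (M g) (A u) = ip L (J g) (J (Madj u))"
  using g u by (simp add: A_def Hk.ip_diff_right M_mem Madj_mem ip_J ip_M)

definition U :: "('x \<Rightarrow> complex) set" where
  "U = cspan {\<lambda>x. k x y | y. True}"

lemma U_subspace: "csubspace U"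
  by (simp add: U_def complex_vector.subspace_span)

lemma kernel_in_U: "kf y \<in> U"
  unfolding U_def by (rule complex_vector.span_base) auto

lemma U_induct [consumes 1, case_names zero step]:
  assumes "u \<in> U" "P 0" "\<And>c y v. v \<in> U \<Longrightarrow> P v \<Longrightarrow> P (scaleC c (kf y) + v)"
  shows "P u"
proof -
  \<comment> \<open>Membership in \<open>U\<close> is carried through the induction because the step
    case of the rule offers it as a hypothesis.\<close>
  have "u \<in> U \<and> P u"
    using assms(1)[unfolded U_def]
  proof (induction rule: complex_vector.span_induct_alt)
    case base
    then show ?case using complex_vector.subspace_0[OF U_subspace] assms(2)
      by (simp del: zero_fun_apply)
  next
    case (step c x v)
    then show ?case using assms(3) U_subspace kernel_in_U
      by (auto intro!: complex_vector.subspace_add complex_vector.subspace_scale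
          simp del: plus_fun_apply)
  qed
  then show ?thesis ..
qed

lemma U_subset: "U \<subseteq> vecs Hk"
  unfolding U_def
  by (rule complex_vector.span_minimal) (auto simp: Hk.kernel_in Hk.subspace)

lemma U_mem: "u \<in> U \<Longrightarrow> u \<in> vecs Hk"
  using U_subset by blast

lemma A_zero: "A 0 = 0"
  using A_diff[of 0 0] by (simp add: Hk.mem_intros)

lemma A_U_mem: "u \<in> U \<Longrightarrow> A u \<in> vecs Hkb"
  by (induction rule: U_induct)
    (auto simp: A_zero A_add A_scaleC A_kernel U_mem Hk.mem_intros Hkb.mem_intros
      Hk.kernel_in Hkb.kernel_in simp del: zero_fun_apply plus_fun_apply)

text \<open>For \<open>v = kf y\<close> we have \<open>A v = kb y\<close>, and both sides are the
  value of \<open>A u\<close> at \<open>y\<close>, by the reproducing property in either space.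
  Conjugate linearity in \<open>v\<close> extends this to \<open>U\<close>.\<close>

lemma ip_A:
  assumes u: "u \<in> U" and "v \<in> U"
  shows "ip Hkb (A u) (A v) = ip Hk (A u) v"
  using \<open>v \<in> U\<close>
proof (induction rule: U_induct)
  case zero
  then show ?case using u by (simp add: A_zero A_U_mem A_mem U_mem Hk.ip_simps Hkb.ip_simps
        del: zero_fun_apply)
next
  case (step c y v)
  have "ip Hkb (A u) (kb y) = ip Hk (A u) (kf y)"
    using u by (simp add: Hk.reproducing[symmetric] Hkb.reproducing[symmetric] A_mem A_U_mem U_mem)
  moreover have "A v \<in> vecs Hkb" "A v \<in> vecs Hk" "v \<in> vecs Hk"
    using step by (simp_all add: A_U_mem A_mem U_mem)
  ultimately show ?case
    using u step by (simp add: A_add A_scaleC A_kernel A_mem A_U_mem U_mem Hk.mem_intros Hkb.mem_intros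
        Hk.kernel_in Hkb.kernel_in Hk.ip_simps Hkb.ip_simps del: plus_fun_apply)
qed

text \<open>By \<open>ip_A\<close> the left side is the inner product of \<open>A u\<close> with
  \<open>u\<close> in \<open>Hk\<close>. Splitting \<open>u\<close> as
  \<open>A u + M (Madj u)\<close> leaves a cross term, which \<open>ip_M_A\<close> identifies as the
  squared norm in \<open>L\<close>.\<close>

lemma norm_A_sq:
  assumes u: "u \<in> U"
  shows "(ip_norm Hkb (A u))\<^sup>2 = (ip_norm Hk (A u))\<^sup>2 + (ip_norm L (J (Madj u)))\<^sup>2"
proof -
  note mem = U_mem[OF u] A_U_mem[OF u] A_mem[OF U_mem[OF u]] Madj_mem[OF U_mem[OF u]]
    M_mem[OF Madj_mem[OF U_mem[OF u]]] J_mem[OF Madj_mem[OF U_mem[OF u]]]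
  have "u = A u + M (Madj u)" by (simp add: A_def)
  then have "ip Hk (A u) u = ip Hk (A u) (A u) + ip Hk (A u) (M (Madj u))"
    using Hk.ip_add_right[of "A u" "A u" "M (Madj u)"] mem by simp
  also have "ip Hk (A u) (M (Madj u)) = cnj (ip L (J (Madj u)) (J (Madj u)))"
    using mem by (simp add: ip_M_A[symmetric] Hk.ip_commute[symmetric])
  finally show ?thesis using mem ip_A[OF u u]
    by (simp add: Hkb.ip_norm_sq Hk.ip_norm_sq L.ip_norm_sq)
qed

section \<open>Continuity of b f at a point for f in the completion\<close>

lemma E_mem: "h \<in> vecs L \<Longrightarrow> E h y \<in> vecs ell2"
  and E_add: "\<lbrakk>h \<in> vecs L; h' \<in> vecs L\<rbrakk> \<Longrightarrow> E (h + h') y = E h y + E h' y"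
  and E_J: "g \<in> vecs K \<Longrightarrow> E (J g) y = g y"
  using eval by (auto simp: is_eval_extension_def bounded_op_def linear_op_def)

lemma E_diff: "\<lbrakk>h \<in> vecs L; h' \<in> vecs L\<rbrakk> \<Longrightarrow> E (h - h') y = E h y - E h' y"
  using E_add[of "h - h'" h'] by (simp add: L.mem_intros)

lemma M_E_J: "g \<in> vecs K \<Longrightarrow> M (E (J g)) = M g"
  by (simp add: mult_op_def E_J)

lemma M_E_zero: "M (E 0) = 0"
  using E_diff[of 0 0] by (simp add: mult_op_def L.mem_intros fun_eq_iff)

text \<open>The value at \<open>y\<close> is the inner product in \<open>ell2\<close> of
  \<open>E h y\<close>, which depends boundedly on \<open>h\<close>, with the conjugate of
  \<open>b y\<close>. The estimate is stated for differences because it serves as a bound, with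
  \<open>h' = 0\<close>, and as continuity.\<close>

lemma M_E_Lipschitz:
  "\<exists>C. \<forall>h\<in>vecs L. \<forall>h'\<in>vecs L. cmod (M (E h) y - M (E h') y) \<le> C * ip_norm L (h - h')"
proof -
  interpret ell2: complex_inner_space ell2 by (rule complex_inner_space_ell2)
  \<comment> \<open>If \<open>k y y = 0\<close>, all functions in \<open>Hk\<close> vanish at \<open>y\<close> and \<open>b y\<close> need not be in \<open>\<ell>\<^sup>2\<close>.\<close>
  define \<beta> where "\<beta> j = (if k y y = 0 then 0 else cnj (b y j))" for j
  obtain C where C: "\<And>h. h \<in> vecs L \<Longrightarrow> ip_norm ell2 (E h y) \<le> C * ip_norm L h"
    using eval unfolding is_eval_extension_def bounded_op_def op_norm_le_def by blast
  have \<beta>: "\<beta> \<in> vecs ell2"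
  proof (cases "k y y = 0")
    case False
    \<comment> \<open>The value of M* k_y at \<open>y\<close> is \<open>k y y\<close> times the
      conjugate of \<open>b y\<close>. It lies in \<open>ell2\<close> since it is a value of
      \<open>E\<close>; divide by \<open>k y y\<close>.\<close>
    have "J (Madj (kf y)) \<in> vecs L" by (simp add: J_mem Madj_mem Hk.kernel_in)
    from E_mem[OF this] have "Madj (kf y) y \<in> vecs ell2"
      by (simp add: E_J Madj_mem Hk.kernel_in)
    then have "scaleC (1 / k y y) (Madj (kf y) y) \<in> vecs ell2" by (rule ell2.scaleC_mem)
    also have "scaleC (1 / k y y) (Madj (kf y) y) = \<beta>"
      using False by (simp add: \<beta>_def scaleC_fun_def scaleC_complex_def Madj_kernel fun_eq_iff)
    finally show ?thesis .
  qed (simp add: \<beta>_def[abs_def] ell2_def)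
  have M_E: "M (E h) y = ip ell2 (E h y) \<beta>" if h: "h \<in> vecs L" for h
  proof (cases "k y y = 0")
    case True
    have "ip_norm Hk (kf y) = 0"
      using Hk.reproducing[OF Hk.kernel_in, of y y] True by (simp add: ip_norm_def)
    then have "kf y = 0" using Hk.ip_norm_eq_0_iff[OF Hk.kernel_in] by blast
    then have "g y j = 0" if "g \<in> vecs K" for g j
      using Hk.reproducing[OF component_mem[OF that, of j], of y]
      by (simp add: Hk.ip_zero_right component_mem that del: zero_fun_apply)
    then have vanish: "g y = 0" if "g \<in> vecs K" for g using that by (simp add: fun_eq_iff)
    \<comment> \<open>All elements of \<open>K\<close> vanish at \<open>y\<close>, so by density of
      the image of \<open>J\<close> the extended evaluation vanishes too. Dividing by
      \<open>\<bar>C\<bar> + 1\<close> is safe for every real \<open>C\<close>, including zero and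
      negative values.\<close>
    have "ip_norm ell2 (E h y) \<le> 0 + \<epsilon>" if "\<epsilon> > 0" for \<epsilon>
    proof -
      have "\<epsilon> / (\<bar>C\<bar> + 1) > 0" using that by (simp add: add_nonneg_pos)
      then obtain g where g: "g \<in> vecs K" "ip_norm L (h - J g) < \<epsilon> / (\<bar>C\<bar> + 1)"
        using J_dense[OF h] by blast
      have "ip_norm ell2 (E h y) = ip_norm ell2 (E (h - J g) y)"
        using h g by (simp add: E_diff J_mem E_J vanish del: zero_fun_apply)
      also have "\<dots> \<le> C * ip_norm L (h - J g)" using h g by (intro C) (simp add: L.mem_intros J_mem)
      also have "\<dots> \<le> (\<bar>C\<bar> + 1) * ip_norm L (h - J g)"
        using h g by (intro mult_right_mono L.ip_norm_nonneg) (auto simp: L.mem_intros J_mem)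
      also have "\<dots> \<le> \<epsilon>" using g by (simp add: field_simps)
      finally show ?thesis by simp
    qed
    then have "ip_norm ell2 (E h y) \<le> 0" by (rule field_le_epsilon)
    then have "E h y = 0"
      using ell2.ip_norm_nonneg[OF E_mem[OF h, of y]] ell2.ip_norm_eq_0_iff[OF E_mem[OF h, of y]] by simp
    then show ?thesis by (simp add: mult_op_def ell2_def)
  next
    case False
    then show ?thesis by (simp add: mult_op_def ell2_def \<beta>_def mult.commute)
  qed
  show ?thesis
  proof (intro exI ballI)
    show "cmod (M (E h) y - M (E h') y) \<le> (ip_norm ell2 \<beta> * C) * ip_norm L (h - h')"
      if h: "h \<in> vecs L" "h' \<in> vecs L" for h h'
    proof -
      have "M (E h) y - M (E h') y = ip ell2 (E (h - h') y) \<beta>"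
        using h by (simp add: M_E E_diff E_mem ell2.ip_diff_left \<beta>)
      then have "cmod (M (E h) y - M (E h') y) \<le> ip_norm ell2 (E (h - h') y) * ip_norm ell2 \<beta>"
        using h by (simp add: ell2.Cauchy_Schwarz E_mem \<beta> L.mem_intros)
      also have "\<dots> \<le> (C * ip_norm L (h - h')) * ip_norm ell2 \<beta>"
        using h by (intro mult_right_mono C ell2.ip_norm_nonneg \<beta>) (simp add: L.mem_intros)
      finally show ?thesis by (simp add: mult_ac)
    qed
  qed
qed

section \<open>The kernel functions as elements of H_k(b)\<close>

text \<open>Applied to differences, these carry the Cauchy property from \<open>Hkb\<close> over to
  \<open>Hk\<close> and \<open>L\<close>.\<close>

lemma norm_A_ge:
  assumes u: "u \<in> U"
  shows "ip_norm Hk (A u) \<le> ip_norm Hkb (A u)" "ip_norm L (J (Madj u)) \<le> ip_norm Hkb (A u)"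
  by (rule power2_le_imp_le; simp add: norm_A_sq[OF u] Hkb.ip_norm_nonneg[OF A_U_mem[OF u]])+

lemma kernel_represents_eval:
  shows kernel_in_Hkb: "kf y \<in> vecs Hkb"
    and ip_A_kernel: "u \<in> U \<Longrightarrow> ip Hkb (A u) (kf y) = u y"
proof -
  obtain C where C: "\<And>h h'. \<lbrakk>h \<in> vecs L; h' \<in> vecs L\<rbrakk> \<Longrightarrow>
      cmod (M (E h) y - M (E h') y) \<le> C * ip_norm L (h - h')"
    using M_E_Lipschitz[of y] by blast
  have bound: "cmod (u y) \<le> (ip_norm Hk (kf y) + \<bar>C\<bar>) * ip_norm Hkb (A u)" if u: "u \<in> U" for u
  proof -
    let ?g = "Madj u"
    note g = Madj_mem[OF U_mem[OF u]]
    have "cmod (M ?g y) \<le> C * ip_norm L (J ?g)"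
      using C[of "J ?g" 0] by (simp add: M_E_J[OF g] M_E_zero J_mem[OF g] L.mem_intros)
    also have "\<dots> \<le> \<bar>C\<bar> * ip_norm L (J ?g)"
      using L.ip_norm_nonneg[OF J_mem[OF g]] by (intro mult_right_mono) auto
    also have "\<dots> \<le> \<bar>C\<bar> * ip_norm Hkb (A u)" using norm_A_ge(2)[OF u] by (intro mult_left_mono) auto
    finally have 1: "cmod (M ?g y) \<le> \<bar>C\<bar> * ip_norm Hkb (A u)" .
    have "cmod (A u y) \<le> ip_norm Hk (A u) * ip_norm Hk (kf y)"
      using Hk.Cauchy_Schwarz[OF A_mem[OF U_mem[OF u]] Hk.kernel_in, of y]
      by (simp add: Hk.reproducing[OF A_mem[OF U_mem[OF u]], of y])
    also have "\<dots> \<le> ip_norm Hkb (A u) * ip_norm Hk (kf y)"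
      using norm_A_ge(1)[OF u] by (intro mult_right_mono Hk.ip_norm_nonneg Hk.kernel_in)
    finally have 2: "cmod (A u y) \<le> ip_norm Hkb (A u) * ip_norm Hk (kf y)" .
    \<comment> \<open>The first summand is controlled by the norm of \<open>A u\<close> in
      \<open>Hk\<close>, the second by the norm of \<open>Madj u\<close> in the completion; both are
      at most the norm of \<open>A u\<close> in \<open>Hkb\<close>.\<close>
    have "u y = A u y + M ?g y" by (simp add: A_def)
    then have "cmod (u y) \<le> cmod (A u y) + cmod (M ?g y)" by (metis norm_triangle_ineq)
    then show ?thesis using 1 2 by (simp add: algebra_simps)
  qed
  obtain v where v: "v \<in> vecs Hkb" and ip_v: "\<And>u. u \<in> U \<Longrightarrow> ip Hkb (A u) v = u y"
  proof (rule Hkb.riesz_representation[where U = U and T = A and \<phi> = "\<lambda>u. u y"])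
    show "\<And>u. u \<in> U \<Longrightarrow> cmod (u y) \<le> (ip_norm Hk (kf y) + \<bar>C\<bar>) * ip_norm Hkb (A u)" by (rule bound)
    show "\<And>c u. u \<in> U \<Longrightarrow> scaleC c u y = c * u y" by (rule scaleC_apply)
  qed (simp_all add: U_subspace A_U_mem A_add A_scaleC U_mem)
  have "v x = k x y" for x
    using Hkb.reproducing[OF v, of x] Hkb.ip_commute[OF Hkb.kernel_in v, of x] ip_v[OF kernel_in_U, of x]
      kernel_commute[of x y] by (simp add: A_kernel)
  then have "v = kf y" by auto
  with v ip_v show "kf y \<in> vecs Hkb" "u \<in> U \<Longrightarrow> ip Hkb (A u) (kf y) = u y" by auto
qed

lemma U_subset_Hkb: "U \<subseteq> vecs Hkb"
  unfolding U_def by (rule complex_vector.span_minimal) (auto simp: kernel_in_Hkb Hkb.subspace)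

section \<open>Density of the span\<close>

lemma orthogonal_kernels_imp_zero:
  assumes ii: "\<And>f. f \<in> vecs L \<Longrightarrow> M (E f) \<in> vecs Hk \<Longrightarrow> f \<in> J ` vecs K"
    and G: "G \<in> vecs Hkb" and orth: "\<And>y. ip Hkb (kf y) G = 0"
  shows "G = 0"
proof -
  have bound: "cmod (ip Hkb u G) \<le> ip_norm Hkb G * ip_norm Hkb u" if "u \<in> vecs Hkb" for u
    using Hkb.Cauchy_Schwarz[OF that G] by (simp add: mult.commute)
  obtain P s where P: "P \<in> vecs Hkb" and s: "\<And>n. s n \<in> U"
    and lim: "ip_tendsto Hkb (\<lambda>n. A (s n)) P"
    and ip_P: "\<And>u. u \<in> U \<Longrightarrow> ip Hkb (A u) P = ip Hkb (A u) G"
    by (rule Hkb.riesz_representation[where U = U and T = A and \<phi> = "\<lambda>u. ip Hkb (A u) G" and C = "ip_norm Hkb G"])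
      (auto simp: U_subspace A_U_mem A_add A_scaleC U_mem G Hkb.ip_simps bound)
  have "P x = G x" for x
    using Hkb.reproducing[OF P, of x] Hkb.reproducing[OF G, of x] ip_P[OF kernel_in_U[of x]]
      Hkb.ip_commute[OF Hkb.kernel_in P, of x] Hkb.ip_commute[OF Hkb.kernel_in G, of x]
    by (simp add: A_kernel)
  then have "P = G" by auto
  note lim = lim[unfolded this]
  note mem = U_mem[OF s] A_U_mem[OF s] A_mem[OF U_mem[OF s]]
    Madj_mem[OF U_mem[OF s]] J_mem[OF Madj_mem[OF U_mem[OF s]]]
  have A_lim: "(\<lambda>n. A (s n) y) \<longlonglongrightarrow> G y" for y
    using Hkb.tendsto_ip_left[OF mem(2) G Hkb.kernel_in lim, of y]
    by (simp add: Hkb.reproducing[symmetric] mem G)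
  have s_lim: "(\<lambda>n. s n y) \<longlonglongrightarrow> 0" for y
    using Hkb.tendsto_ip_left[OF mem(2) G kernel_in_Hkb lim, of y]
      Hkb.ip_commute[OF kernel_in_Hkb G, of y] by (simp add: ip_A_kernel s orth)
  have Cauchy: "ip_Cauchy Hkb (\<lambda>n. A (s n))"
    by (rule Hkb.ip_tendsto_imp_Cauchy[OF mem(2) G lim])
  have s_diff: "s m - s n \<in> U" for m n
    using s U_subspace by (simp add: complex_vector.subspace_diff)
  have "ip_Cauchy Hk (\<lambda>n. A (s n))"
    using Cauchy norm_A_ge(1)[OF s_diff] unfolding ip_Cauchy_def
    by (simp add: A_diff mem) (meson order.strict_trans1)
  then obtain F where F: "F \<in> vecs Hk" and F_lim: "ip_tendsto Hk (\<lambda>n. A (s n)) F"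
    using Hk.complete[of "\<lambda>n. A (s n)"] mem by blast
  \<comment> \<open>Convergence in \<open>Hk\<close> and in \<open>Hkb\<close> both imply pointwise
    convergence, so the two limits coincide and \<open>G\<close> also lies in \<open>Hk\<close>.
    This is what makes (ii) applicable below.\<close>
  have "F y = G y" for y
    using Hk.tendsto_ip_left[OF mem(3) F Hk.kernel_in F_lim, of y] A_lim[of y]
    by (simp add: Hk.reproducing[symmetric] mem F LIMSEQ_unique)
  then have "F = G" by auto
  note G' = F[unfolded this] and G_lim = F_lim[unfolded this]
  have "ip_Cauchy L (\<lambda>n. J (Madj (s n)))"
    using Cauchy norm_A_ge(2)[OF s_diff] unfolding ip_Cauchy_def
    by (simp add: A_diff Madj_diff J_diff mem) (meson order.strict_trans1)
  then obtain h where h: "h \<in> vecs L" and h_lim: "ip_tendsto L (\<lambda>n. J (Madj (s n))) h"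
    using L.complete[of "\<lambda>n. J (Madj (s n))"] mem by blast
  have M_E_h: "M (E h) y = - G y" for y
  proof -
    obtain C where C: "\<And>h h'. \<lbrakk>h \<in> vecs L; h' \<in> vecs L\<rbrakk> \<Longrightarrow>
        cmod (M (E h) y - M (E h') y) \<le> C * ip_norm L (h - h')"
      using M_E_Lipschitz[of y] by blast
    have bound: "cmod (M (Madj (s n)) y - M (E h) y) \<le> C * ip_norm L (J (Madj (s n)) - h)" for n
      using C[OF mem(5)[of n] h] by (simp add: M_E_J[OF mem(4)])
    have "(\<lambda>n. C * ip_norm L (J (Madj (s n)) - h)) \<longlonglongrightarrow> 0"
      using h_lim unfolding ip_tendsto_def by (rule tendsto_mult_right_zero)
    with always_eventually[OF allI[OF bound]]
    have "(\<lambda>n. M (Madj (s n)) y - M (E h) y) \<longlonglongrightarrow> 0" by (rule Lim_null_comparison)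
    then have "(\<lambda>n. M (Madj (s n)) y) \<longlonglongrightarrow> M (E h) y" by (rule LIM_zero_cancel)
    \<comment> \<open>M M* s_n is s_n minus A s_n, whose pointwise limits are 0 and
      \<open>G y\<close>.\<close>
    moreover have "(\<lambda>n. M (Madj (s n)) y) \<longlonglongrightarrow> 0 - G y"
      using tendsto_diff[OF s_lim[of y] A_lim[of y]] by (simp add: A_def)
    ultimately show ?thesis using LIMSEQ_unique by fastforce
  qed
  then have "M (E h) = - G" by auto
  then obtain g where g: "g \<in> vecs K" and h_eq: "h = J g"
    using ii[OF h] G' complex_vector.subspace_neg[OF Hk.subspace] by auto
  have G_eq: "G = - M g"
    using \<open>M (E h) = - G\<close> g by (simp add: h_eq M_E_J)
  \<comment> \<open>One sequence, two limits: computed in \<open>L\<close> it tends to the inner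
    product of \<open>J g\<close> with itself, and by \<open>ip_M_A\<close> it is also computed in
    \<open>Hk\<close>.\<close>
  have "(\<lambda>n. ip L (J g) (J (Madj (s n)))) \<longlonglongrightarrow> ip L (J g) (J g)"
    using L.tendsto_ip_right[OF mem(5) h h h_lim] by (simp add: h_eq)
  moreover have "(\<lambda>n. ip L (J g) (J (Madj (s n)))) \<longlonglongrightarrow> ip Hk (M g) G"
    using Hk.tendsto_ip_right[OF mem(3) G' M_mem[OF g] G_lim] by (simp add: ip_M_A g mem)
  ultimately have "ip L (J g) (J g) = ip Hk (M g) G" by (rule LIMSEQ_unique)
  moreover have "ip Hk (M g) G = - ip Hk (M g) (M g)"
    using Hk.ip_diff_right[of "M g" 0 "M g"] M_mem[OF g] by (simp add: G_eq Hk.mem_intros Hk.ip_zero_right)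
  \<comment> \<open>\<open>ip_J\<close> expands the left side to
    \<open>ip K g g - ip Hk (M g) (M g)\<close>; the terms in \<open>M g\<close> cancel.\<close>
  ultimately have "ip K g g = 0" using ip_J[OF g g] by simp
  then have "g = 0" using K.ip_norm_eq_0_iff[OF g] by (simp add: ip_norm_def)
  then show ?thesis using G_eq M_scaleC[OF g, of 0] by simp
qed

lemma U_dense:
  assumes ii: "\<And>f. f \<in> vecs L \<Longrightarrow> M (E f) \<in> vecs Hk \<Longrightarrow> f \<in> J ` vecs K"
  shows "ip_dense Hkb U"
  unfolding ip_dense_def
proof (intro conjI ballI allI impI U_subset_Hkb)
  fix F and \<epsilon> :: real
  assume F: "F \<in> vecs Hkb" and "\<epsilon> > 0"
  have mem: "u \<in> vecs Hkb" if "u \<in> U" for u using that U_subset_Hkb by blast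
  have bound: "cmod (ip Hkb u F) \<le> ip_norm Hkb F * ip_norm Hkb u" if "u \<in> vecs Hkb" for u
    using Hkb.Cauchy_Schwarz[OF that F] by (simp add: mult.commute)
  \<comment> \<open>With the identity as \<open>T\<close>, the Riesz vector is the projection of
    \<open>F\<close> to the closure of \<open>U\<close>, and its minimizing sequence provides the
    approximants.\<close>
  obtain P s where P: "P \<in> vecs Hkb" and s: "\<And>n. s n \<in> U" and lim: "ip_tendsto Hkb s P"
    and ip_P: "\<And>u. u \<in> U \<Longrightarrow> ip Hkb u P = ip Hkb u F"
    by (rule Hkb.riesz_representation[where U = U and T = "\<lambda>u. u" and \<phi> = "\<lambda>u. ip Hkb u F" and C = "ip_norm Hkb F"])
      (auto simp: U_subspace mem F Hkb.ip_simps bound)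
  have "F - P = 0"
    using F P ip_P[OF kernel_in_U]
    by (intro orthogonal_kernels_imp_zero[OF ii])
      (auto simp: Hkb.mem_intros Hkb.ip_diff_right kernel_in_Hkb)
  then have "P = F" by simp
  have "\<forall>\<^sub>F n in sequentially. ip_norm Hkb (s n - F) < \<epsilon>"
    using lim \<open>\<epsilon> > 0\<close> unfolding ip_tendsto_def \<open>P = F\<close> by (rule order_tendstoD)
  then obtain n where "ip_norm Hkb (s n - F) < \<epsilon>" by (auto simp: eventually_sequentially)
  then show "\<exists>u\<in>U. ip_norm Hkb (F - u) < \<epsilon>"
    using s mem[OF s] F by (auto simp: Hkb.ip_norm_commute)
qed

end

theorem theorem6:
  fixes k :: "'x \<Rightarrow> 'x \<Rightarrow> complex"
    and Hk :: "('x \<Rightarrow> complex) ip_space"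
    and b :: "'x \<Rightarrow> nat \<Rightarrow> complex"
    and Mb_adj :: "('x \<Rightarrow> complex) \<Rightarrow> 'x \<Rightarrow> nat \<Rightarrow> complex"
    and \<Delta> :: "('x \<Rightarrow> nat \<Rightarrow> complex) \<Rightarrow> 'x \<Rightarrow> nat \<Rightarrow> complex"
    and L\<Delta> :: "('l::complex_vector) ip_space"
    and J :: "('x \<Rightarrow> nat \<Rightarrow> complex) \<Rightarrow> 'l"
    and E :: "'l \<Rightarrow> 'x \<Rightarrow> nat \<Rightarrow> complex"
    and Hkb :: "('x \<Rightarrow> complex) ip_space"
  assumes kernel: "psd_kernel k"
    and Hk: "rkhs k Hk"
    and mult: "multiplier Hk b"
    and contr: "op_norm_le (tensor_ell2 Hk) Hk (mult_op b) 1"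
    and adj: "is_adjoint (tensor_ell2 Hk) Hk (mult_op b) Mb_adj"
    and Delta: "is_positive_sqrt (tensor_ell2 Hk) (\<lambda>f. f - Mb_adj (mult_op b f)) \<Delta>"
    and inj: "inj_on \<Delta> (vecs (tensor_ell2 Hk))"
    and i: "\<And>y. \<exists>d>0. \<forall>e\<in>vecs ell2. \<forall>g\<in>vecs (tensor_ell2 Hk).
              cmod (ip ell2 (g y) e) \<le> d * ip_norm (renormed (tensor_ell2 Hk) \<Delta>) g * ip_norm ell2 e"
    and compl: "is_completion (renormed (tensor_ell2 Hk) \<Delta>) L\<Delta> J"
    and eval: "is_eval_extension (tensor_ell2 Hk) L\<Delta> J E"
    and ii: "\<And>f. f \<in> vecs L\<Delta> \<Longrightarrow> mult_op b (E f) \<in> vecs Hk \<Longrightarrow> f \<in> J ` vecs (tensor_ell2 Hk)"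
    and Hkb: "rkhs (dbr_kernel k b) Hkb"
  shows "cspan {\<lambda>x. k x y | y. True} \<subseteq> vecs Hkb \<and>
    ip_dense Hkb (cspan {\<lambda>x. k x y | y. True})"
proof -
  interpret Hk: rkhs k Hk by fact
  interpret Hkb: rkhs "dbr_kernel k b" Hkb by fact
  interpret L: complex_hilbert_space L\<Delta> using compl by (simp add: is_completion_def)
  interpret row_multiplier k Hk b Hkb L\<Delta> Mb_adj \<Delta> J E
    by unfold_locales (fact mult adj Delta compl eval)+
  show ?thesis using U_subset_Hkb U_dense[OF ii] by (simp add: U_def)
qed

end
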